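(* Let $S$ be a Polish space and $\mathcal{F}$ a Banach subspace of the space $\mathcal{C}(S)$ of continuous functions $S\to\mathbb{R}$. Let $\pi$ be a probability measure on $S$, and $X_t^\pi$ a $\pi$-ergodic Markov process with strongly continuous semigroup $\{P_t\}_{t \geq 0}$ over $\mathcal{F}$ and Markov generator $\mathcal{A}_{\pi}$. Further, let $H \subseteq \mathcal{F}$ be a reproducing kernel Hilbert space (RKHS) with reproducing kernel $k$. Assuming that $k(\cdot,x) \in \mathrm{dom}(\mathcal{A}_\pi)$ for any $x \in S$, the space $H_{\pi} = \mathcal{A}_{\pi} H$ is a RKHS with reproducing kernel $$k_{\pi}(x, y) = (\mathcal{A}_{\pi} \otimes \mathcal{A}_{\pi})k(x,y),\qquad x,y\in S.$$
   Context: The semigroup is $P_tf(x)=\mathbb{E}[f(X_t^\pi)\mid X_0^\pi=x]$ for $f\in\mathcal{F}$. The Markov generator $\mathcal{A}_\pi$ is the linear operator $\mathcal{A}_\pi f=\lim_{t\to0^+}\frac1t(P_tf-f)$, with domain $\mathrm{dom}(\mathcal{A}_\pi)$ the set of $f\in\mathcal{F}$ for which this limit exists in the topology of $\mathcal{F}$. "$\pi$-ergodic" means that $\pi$ is the stationary distribution of $X_t^\pi$ and $X_t^\pi$ converges in distribution to $\pi$ as $t\to\infty$. For operators $\mathcal{A}_1,\mathcal{A}_2$ acting on scalar-valued functions on $S$, and $f:S\times S\to\mathbb{R}$, $(\mathcal{A}_1\otimes\mathcal{A}_2)f(x,y)=(\mathcal{A}_1f_2(\cdot,y))(x)$, where $f_2(x,y)=(\mathcal{A}_2f(x,\cdot))(y)$.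 An RKHS on $S$ is a Hilbert space $H$ of functions $h:S\to\mathbb{R}$ with bounded evaluation functionals; its reproducing kernel is the unique symmetric positive-definite $k$ with $k(x,\cdot)\in H$ and $h(x)=\langle h,k(x,\cdot)\rangle_H$ for all $h\in H$, $x\in S$.
   Formalization: The formal theorem also assumes H ⊆ dom(A_π), so that A_π H is defined; having only k(·,x) ∈ dom(A_π) does not suffice, since A_π(H ∩ dom(A_π)) can fail to be the RKHS with kernel k_π. *)

theory Defs
  imports "HOL-Probability.Probability"
begin

section \<open>Spaces of real-valued functions\<close>

text \<open>Function spaces are carrier sets \<open>V\<close> of functions together with a norm or an inner
  product, about which nothing is assumed off the carrier.\<close>

definition function_subspace :: "('s \<Rightarrow> real) set \<Rightarrow> bool" where
  "function_subspace V \<longleftrightarrow>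
     (\<lambda>x. 0) \<in> V \<and>
     (\<forall>f\<in>V. \<forall>g\<in>V. (\<lambda>x. f x + g x) \<in> V) \<and>
     (\<forall>c. \<forall>f\<in>V. (\<lambda>x. c * f x) \<in> V)"

definition norm_on :: "('s \<Rightarrow> real) set \<Rightarrow> (('s \<Rightarrow> real) \<Rightarrow> real) \<Rightarrow> bool" where
  "norm_on V N \<longleftrightarrow>
     (\<forall>f\<in>V. 0 \<le> N f) \<and>
     (\<forall>f\<in>V. N f = 0 \<longleftrightarrow> f = (\<lambda>x. 0)) \<and>
     (\<forall>c. \<forall>f\<in>V. N (\<lambda>x. c * f x) = \<bar>c\<bar> * N f) \<and>
     (\<forall>f\<in>V. \<forall>g\<in>V. N (\<lambda>x. f x + g x) \<le> N f + N g)"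

definition complete_on :: "('s \<Rightarrow> real) set \<Rightarrow> (('s \<Rightarrow> real) \<Rightarrow> real) \<Rightarrow> bool" where
  "complete_on V N \<longleftrightarrow>
     (\<forall>u :: nat \<Rightarrow> 's \<Rightarrow> real.
        (\<forall>n. u n \<in> V) \<longrightarrow>
        (\<forall>e>0. \<exists>n0. \<forall>m\<ge>n0. \<forall>n\<ge>n0. N (\<lambda>x. u m x - u n x) < e) \<longrightarrow>
        (\<exists>f\<in>V. (\<lambda>n. N (\<lambda>x. u n x - f x)) \<longlonglongrightarrow> 0))"

text \<open>The last condition says that the inclusion into the continuous functions is continuous for
  the topology of uniform convergence on compact sets. Closed subspaces of the bounded continuous
  functions under the supremum norm are instances.\<close>

definition banach_subspace_of_continuous ::
    "('s::topological_space \<Rightarrow> real) set \<Rightarrow> (('s \<Rightarrow> real) \<Rightarrow> real) \<Rightarrow> bool" where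
  "banach_subspace_of_continuous V N \<longleftrightarrow>
     function_subspace V \<and> norm_on V N \<and> complete_on V N \<and>
     (\<forall>f\<in>V. continuous_on UNIV f) \<and>
     (\<forall>K. compact K \<longrightarrow> (\<exists>C. \<forall>f\<in>V. \<forall>x\<in>K. \<bar>f x\<bar> \<le> C * N f))"


section \<open>Reproducing kernel Hilbert spaces\<close>

definition inner_product_on ::
    "('s \<Rightarrow> real) set \<Rightarrow> (('s \<Rightarrow> real) \<Rightarrow> ('s \<Rightarrow> real) \<Rightarrow> real) \<Rightarrow> bool" where
  "inner_product_on V ip \<longleftrightarrow>
     (\<forall>f\<in>V. \<forall>g\<in>V. ip f g = ip g f) \<and>
     (\<forall>f\<in>V. \<forall>g\<in>V. \<forall>h\<in>V. ip (\<lambda>x. f x + g x) h = ip f h + ip g h) \<and>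
     (\<forall>c. \<forall>f\<in>V. \<forall>h\<in>V. ip (\<lambda>x. c * f x) h = c * ip f h) \<and>
     (\<forall>f\<in>V. 0 \<le> ip f f) \<and>
     (\<forall>f\<in>V. ip f f = 0 \<longleftrightarrow> f = (\<lambda>x. 0))"

definition hilbert_function_space ::
    "('s \<Rightarrow> real) set \<Rightarrow> (('s \<Rightarrow> real) \<Rightarrow> ('s \<Rightarrow> real) \<Rightarrow> real) \<Rightarrow> bool" where
  "hilbert_function_space V ip \<longleftrightarrow>
     function_subspace V \<and> inner_product_on V ip \<and> complete_on V (\<lambda>f. sqrt (ip f f))"

definition rkhs ::
    "('s \<Rightarrow> real) set \<Rightarrow> (('s \<Rightarrow> real) \<Rightarrow> ('s \<Rightarrow> real) \<Rightarrow> real) \<Rightarrow> bool" where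
  "rkhs H ip \<longleftrightarrow>
     hilbert_function_space H ip \<and>
     (\<forall>x. \<exists>C. \<forall>h\<in>H. \<bar>h x\<bar> \<le> C * sqrt (ip h h))"

definition positive_definite_kernel :: "('s \<Rightarrow> 's \<Rightarrow> real) \<Rightarrow> bool" where
  "positive_definite_kernel k \<longleftrightarrow>
     (\<forall>A c. finite A \<longrightarrow> 0 \<le> (\<Sum>x\<in>A. \<Sum>y\<in>A. c x * c y * k x y))"

definition reproducing_kernel ::
    "('s \<Rightarrow> real) set \<Rightarrow> (('s \<Rightarrow> real) \<Rightarrow> ('s \<Rightarrow> real) \<Rightarrow> real) \<Rightarrow> ('s \<Rightarrow> 's \<Rightarrow> real) \<Rightarrow> bool" where
  "reproducing_kernel H ip k \<longleftrightarrow>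
     (\<forall>x y. k x y = k y x) \<and> positive_definite_kernel k \<and>
     (\<forall>x. (\<lambda>y. k x y) \<in> H) \<and>
     (\<forall>h\<in>H. \<forall>x. h x = ip h (\<lambda>y. k x y))"


section \<open>Markov processes\<close>

definition history :: "'w measure \<Rightarrow> (real \<Rightarrow> 'w \<Rightarrow> 's::topological_space) \<Rightarrow> real \<Rightarrow> 'w measure" where
  "history \<Omega> X s =
     sigma (space \<Omega>) {X u -` B \<inter> space \<Omega> | u B. 0 \<le> u \<and> u \<le> s \<and> B \<in> sets borel}"

text \<open>A time-homogeneous Markov process \<open>X\<close> with time set \<open>{0..}\<close>, given by the laws \<open>P x\<close> on the
  measurable space \<open>\<Omega>\<close> of the process conditioned to start from \<open>x\<close>. The measure carried by
  \<open>\<Omega>\<close> is irrelevant.\<close>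

definition markov_process ::
    "'w measure \<Rightarrow> ('s::polish_space \<Rightarrow> 'w measure) \<Rightarrow> (real \<Rightarrow> 'w \<Rightarrow> 's) \<Rightarrow> bool" where
  "markov_process \<Omega> P X \<longleftrightarrow>
     P \<in> borel \<rightarrow>\<^sub>M prob_algebra \<Omega> \<and>
     (\<forall>t\<ge>0. X t \<in> \<Omega> \<rightarrow>\<^sub>M borel) \<and>
     (\<forall>x. AE \<omega> in P x. X 0 \<omega> = x) \<and>
     (\<forall>x. \<forall>s\<ge>0. \<forall>t\<ge>0. \<forall>B\<in>sets borel. AE \<omega> in P x.
        real_cond_exp (P x) (history \<Omega> X s) (\<lambda>\<omega>'. indicator B (X (s + t) \<omega>')) \<omega> =
        measure (P (X s \<omega>)) (X t -` B \<inter> space \<Omega>))"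

definition stationary_distribution ::
    "('s::polish_space \<Rightarrow> 'w measure) \<Rightarrow> (real \<Rightarrow> 'w \<Rightarrow> 's) \<Rightarrow> 's measure \<Rightarrow> bool" where
  "stationary_distribution P X \<pi> \<longleftrightarrow>
     (\<forall>t\<ge>0. \<pi> \<bind> (\<lambda>x. distr (P x) borel (X t)) = \<pi>)"

definition converges_in_distribution ::
    "('s::polish_space \<Rightarrow> 'w measure) \<Rightarrow> (real \<Rightarrow> 'w \<Rightarrow> 's) \<Rightarrow> 's measure \<Rightarrow> bool" where
  "converges_in_distribution P X \<pi> \<longleftrightarrow>
     (\<forall>x. \<forall>f :: 's \<Rightarrow> real. continuous_on UNIV f \<longrightarrow> bounded (range f) \<longrightarrow>
        ((\<lambda>t. \<integral>\<omega>. f (X t \<omega>) \<partial>P x) \<longlongrightarrow> (\<integral>y. f y \<partial>\<pi>)) at_top)"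

definition ergodic_process ::
    "('s::polish_space \<Rightarrow> 'w measure) \<Rightarrow> (real \<Rightarrow> 'w \<Rightarrow> 's) \<Rightarrow> 's measure \<Rightarrow> bool" where
  "ergodic_process P X \<pi> \<longleftrightarrow>
     stationary_distribution P X \<pi> \<and> converges_in_distribution P X \<pi>"

definition transition_semigroup ::
    "('s \<Rightarrow> 'w measure) \<Rightarrow> (real \<Rightarrow> 'w \<Rightarrow> 's) \<Rightarrow> real \<Rightarrow> ('s \<Rightarrow> real) \<Rightarrow> 's \<Rightarrow> real" where
  "transition_semigroup P X t f x = (\<integral>\<omega>. f (X t \<omega>) \<partial>P x)"


section \<open>Strongly continuous semigroups and generators\<close>

definition bounded_operator_on ::
    "('s \<Rightarrow> real) set \<Rightarrow> (('s \<Rightarrow> real) \<Rightarrow> real) \<Rightarrow> (('s \<Rightarrow> real) \<Rightarrow> 's \<Rightarrow> real) \<Rightarrow> bool" where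
  "bounded_operator_on V N L \<longleftrightarrow>
     (\<forall>f\<in>V. L f \<in> V) \<and>
     (\<forall>f\<in>V. \<forall>g\<in>V. L (\<lambda>x. f x + g x) = (\<lambda>x. L f x + L g x)) \<and>
     (\<forall>c. \<forall>f\<in>V. L (\<lambda>x. c * f x) = (\<lambda>x. c * L f x)) \<and>
     (\<exists>C. \<forall>f\<in>V. N (L f) \<le> C * N f)"

definition strongly_continuous_semigroup ::
    "('s \<Rightarrow> real) set \<Rightarrow> (('s \<Rightarrow> real) \<Rightarrow> real) \<Rightarrow>
     (real \<Rightarrow> ('s \<Rightarrow> real) \<Rightarrow> 's \<Rightarrow> real) \<Rightarrow> bool" where
  "strongly_continuous_semigroup V N T \<longleftrightarrow>
     (\<forall>t\<ge>0. bounded_operator_on V N (T t)) \<and>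
     (\<forall>f\<in>V. T 0 f = f) \<and>
     (\<forall>s\<ge>0. \<forall>t\<ge>0. \<forall>f\<in>V. T (s + t) f = T s (T t f)) \<and>
     (\<forall>f\<in>V. ((\<lambda>t. N (\<lambda>x. T t f x - f x)) \<longlongrightarrow> 0) (at_right 0))"

text \<open>Integrability is required because functions in \<open>V\<close> may be unbounded, and the Bochner
  integral of a non-integrable function is \<open>0\<close>.\<close>

definition strongly_continuous_process_on ::
    "('s \<Rightarrow> real) set \<Rightarrow> (('s \<Rightarrow> real) \<Rightarrow> real) \<Rightarrow>
     ('s \<Rightarrow> 'w measure) \<Rightarrow> (real \<Rightarrow> 'w \<Rightarrow> 's) \<Rightarrow> bool" where
  "strongly_continuous_process_on V N P X \<longleftrightarrow>
     (\<forall>t\<ge>0. \<forall>f\<in>V. \<forall>x. integrable (P x) (\<lambda>\<omega>. f (X t \<omega>))) \<and>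
     strongly_continuous_semigroup V N (transition_semigroup P X)"

definition generator_limit ::
    "('s \<Rightarrow> real) set \<Rightarrow> (('s \<Rightarrow> real) \<Rightarrow> real) \<Rightarrow> (real \<Rightarrow> ('s \<Rightarrow> real) \<Rightarrow> 's \<Rightarrow> real) \<Rightarrow>
     ('s \<Rightarrow> real) \<Rightarrow> ('s \<Rightarrow> real) \<Rightarrow> bool" where
  "generator_limit V N T f g \<longleftrightarrow>
     g \<in> V \<and> ((\<lambda>t. N (\<lambda>x. (1 / t) * (T t f x - f x) - g x)) \<longlongrightarrow> 0) (at_right 0)"

definition generator_dom ::
    "('s \<Rightarrow> real) set \<Rightarrow> (('s \<Rightarrow> real) \<Rightarrow> real) \<Rightarrow> (real \<Rightarrow> ('s \<Rightarrow> real) \<Rightarrow> 's \<Rightarrow> real) \<Rightarrow>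
     ('s \<Rightarrow> real) set" where
  "generator_dom V N T = {f \<in> V. \<exists>g. generator_limit V N T f g}"

text \<open>The generator is meaningful on \<open>generator_dom\<close> only.\<close>

definition generator ::
    "('s \<Rightarrow> real) set \<Rightarrow> (('s \<Rightarrow> real) \<Rightarrow> real) \<Rightarrow> (real \<Rightarrow> ('s \<Rightarrow> real) \<Rightarrow> 's \<Rightarrow> real) \<Rightarrow>
     ('s \<Rightarrow> real) \<Rightarrow> 's \<Rightarrow> real" where
  "generator V N T f = (THE g. generator_limit V N T f g)"

definition operator_tensor ::
    "(('s \<Rightarrow> real) \<Rightarrow> 's \<Rightarrow> real) \<Rightarrow> (('s \<Rightarrow> real) \<Rightarrow> 's \<Rightarrow> real) \<Rightarrow>
     ('s \<Rightarrow> 's \<Rightarrow> real) \<Rightarrow> 's \<Rightarrow> 's \<Rightarrow> real" where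
  "operator_tensor A1 A2 f x y = A1 (\<lambda>x'. A2 (\<lambda>y'. f x' y') y) x"

text \<open>Both applications in \<open>operator_tensor\<close> are to functions in the respective domains.\<close>

definition operator_tensor_defined ::
    "('s \<Rightarrow> real) set \<Rightarrow> ('s \<Rightarrow> real) set \<Rightarrow> (('s \<Rightarrow> real) \<Rightarrow> 's \<Rightarrow> real) \<Rightarrow>
     ('s \<Rightarrow> 's \<Rightarrow> real) \<Rightarrow> bool" where
  "operator_tensor_defined D1 D2 A2 f \<longleftrightarrow>
     (\<forall>x. (\<lambda>y. f x y) \<in> D2) \<and> (\<forall>y. (\<lambda>x. A2 (\<lambda>y'. f x y') y) \<in> D1)"

end

theory Submission
  imports Defs
begin

text \<open>Write \<open>A\<close> for the generator and \<open>\<langle>\<cdot>, \<cdot>\<rangle>\<close> for the inner product of \<open>H\<close>. The point is that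
  \<open>h \<mapsto> A h x\<close> is a bounded linear functional on \<open>H\<close> for every \<open>x\<close>. The inclusion of \<open>H\<close> in \<open>F\<close> is
  bounded by the closed graph theorem (\<open>inclusion_bounded\<close>), because evaluation at a point is
  continuous on both spaces. So the difference quotients \<open>h \<mapsto> (T t h x - h x) / t\<close> are bounded on
  \<open>H\<close>, and their pointwise limit as \<open>t \<rightarrow> 0\<close> is bounded by the Banach--Steinhaus theorem
  (\<open>pointwise_limit_of_functionals_bounded\<close>). This argument does not use that the generator is a
  closed operator. Both theorems follow from the equivalence of comparable complete norms
  (\<open>comparable_complete_norms_equivalent\<close>), which is derived from Baire's theorem.

  By the Riesz theorem there are \<open>\<phi> x \<in> H\<close> with \<open>A h x = \<langle>h, \<phi> x\<rangle>\<close> for all \<open>h \<in> H\<close>. Taking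
  \<open>h = k x\<close> shows that the generator applied to the second argument of \<open>k\<close> is
  \<open>A (k x) y = \<phi> y x\<close>, a function of \<open>x\<close> that lies in \<open>H\<close>. Applying the generator once more
  gives \<open>(A \<otimes> A) k x y = A (\<phi> y) x = \<langle>\<phi> y, \<phi> x\<rangle>\<close>. A kernel of this form belongs to the image
  of the map \<open>h \<mapsto> (\<lambda>x. \<langle>h, \<phi> x\<rangle>)\<close>, which is \<open>A\<close> on \<open>H\<close>, with the inner product transported from
  the orthogonal complement of the null space (\<open>rkhs_feature_map_image\<close>).\<close>

section \<open>Complete norms on function spaces\<close>

locale function_space =
  fixes V :: "('s \<Rightarrow> real) set"
  assumes subspace: "function_subspace V"
begin

lemma zero_mem: "(\<lambda>x. 0) \<in> V"
  and add_mem: "f \<in> V \<Longrightarrow> g \<in> V \<Longrightarrow> (\<lambda>x. f x + g x) \<in> V"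
  and scale_mem: "f \<in> V \<Longrightarrow> (\<lambda>x. c * f x) \<in> V"
  using subspace by (auto simp: function_subspace_def)

lemma diff_mem: "f \<in> V \<Longrightarrow> g \<in> V \<Longrightarrow> (\<lambda>x. f x - g x) \<in> V"
  using add_mem[of f "\<lambda>x. (-1) * g x"] scale_mem[of g "-1"] by simp

end

text \<open>As in the definition of \<^const>\<open>norm_on\<close>, nothing is known about \<open>N\<close> off the carrier \<open>V\<close>, so
  every rule carries membership premises.\<close>

locale normed_function_space = function_space V
  for V :: "('s \<Rightarrow> real) set" +
  fixes N :: "('s \<Rightarrow> real) \<Rightarrow> real"
  assumes norm: "norm_on V N"
begin

lemma N_nonneg: "f \<in> V \<Longrightarrow> 0 \<le> N f"
  and N_eq_0: "f \<in> V \<Longrightarrow> N f = 0 \<longleftrightarrow> f = (\<lambda>x. 0)"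
  and N_scale: "f \<in> V \<Longrightarrow> N (\<lambda>x. c * f x) = \<bar>c\<bar> * N f"
  and N_triangle: "f \<in> V \<Longrightarrow> g \<in> V \<Longrightarrow> N (\<lambda>x. f x + g x) \<le> N f + N g"
  using norm by (auto simp: norm_on_def)

lemma N_diff_commute:
  assumes "f \<in> V" "g \<in> V"
  shows "N (\<lambda>x. f x - g x) = N (\<lambda>x. g x - f x)"
  using N_scale[OF diff_mem[OF assms], of "-1"] by simp

lemma N_diff_triangle:
  assumes "f \<in> V" "g \<in> V" "h \<in> V"
  shows "N (\<lambda>x. f x - h x) \<le> N (\<lambda>x. f x - g x) + N (\<lambda>x. g x - h x)"
  using N_triangle[OF diff_mem[OF assms(1,2)] diff_mem[OF assms(2,3)]] by simp

lemma N_diff_le: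
  assumes "f \<in> V" "g \<in> V"
  shows "N (\<lambda>x. f x - g x) \<le> N f + N g"
  using N_diff_triangle[OF assms(1) zero_mem assms(2)] N_diff_commute[OF zero_mem assms(2)]
  by simp

lemma N_le_diff:
  assumes "f \<in> V" "g \<in> V"
  shows "N f \<le> N (\<lambda>x. f x - g x) + N g"
  using N_diff_triangle[OF assms zero_mem] by simp

text \<open>The metric of the norm is set to \<open>0\<close> off the carrier, where a \<^locale>\<open>Metric_space\<close> must
  still be nonnegative and symmetric.\<close>

lemma metric_space: "Metric_space V (\<lambda>f g. if f \<in> V \<and> g \<in> V then N (\<lambda>x. f x - g x) else 0)"
proof
  fix f g
  show "0 \<le> (if f \<in> V \<and> g \<in> V then N (\<lambda>x. f x - g x) else 0)"
    using N_nonneg diff_mem by simp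
  show "(if f \<in> V \<and> g \<in> V then N (\<lambda>x. f x - g x) else 0) =
        (if g \<in> V \<and> f \<in> V then N (\<lambda>x. g x - f x) else 0)"
    using N_diff_commute by auto
next
  fix f g assume fg: "f \<in> V" "g \<in> V"
  show "(if f \<in> V \<and> g \<in> V then N (\<lambda>x. f x - g x) else 0) = 0 \<longleftrightarrow> f = g"
    using N_eq_0[OF diff_mem[OF fg]] fg by (auto simp: fun_eq_iff)
next
  fix f g h assume "f \<in> V" "g \<in> V" "h \<in> V"
  then show "(if f \<in> V \<and> h \<in> V then N (\<lambda>x. f x - h x) else 0)
      \<le> (if f \<in> V \<and> g \<in> V then N (\<lambda>x. f x - g x) else 0)
        + (if g \<in> V \<and> h \<in> V then N (\<lambda>x. g x - h x) else 0)"
    using N_diff_triangle by simp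
qed

text \<open>Baire's theorem: if a complete space is covered by countably many sets, then one of
  them is dense in some ball.\<close>

lemma countable_cover_somewhere_dense:
  assumes complete: "complete_on V N"
    and cover: "\<And>f. f \<in> V \<Longrightarrow> \<exists>n::nat. f \<in> E n"
  shows "\<exists>n a r. a \<in> V \<and> 0 < r \<and>
    (\<forall>f\<in>V. N (\<lambda>x. f x - a x) < r \<longrightarrow> (\<forall>e>0. \<exists>g\<in>E n \<inter> V. N (\<lambda>x. f x - g x) < e))"
proof -
  define d where "d f g = (if f \<in> V \<and> g \<in> V then N (\<lambda>x. f x - g x) else 0)" for f g
  interpret Metric_space V d
    using metric_space unfolding d_def .
  have mcomplete
    unfolding mcomplete_def
  proof (intro allI impI)
    fix u assume u: "MCauchy u"
    then have uV: "u n \<in> V" for n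
      by (auto simp: MCauchy_def)
    have "\<forall>e>0. \<exists>n0. \<forall>m\<ge>n0. \<forall>n\<ge>n0. N (\<lambda>x. u m x - u n x) < e"
      using u uV by (simp add: MCauchy_def d_def)
    then obtain f where f: "f \<in> V" "(\<lambda>n. N (\<lambda>x. u n x - f x)) \<longlonglongrightarrow> 0"
      using complete uV unfolding complete_on_def by blast
    then have "limitin mtopology u f sequentially"
      using uV by (simp add: limitin_metric_dist_null d_def)
    then show "\<exists>f. limitin mtopology u f sequentially"
      by blast
  qed
  define cl where "cl n = mtopology closure_of (E n \<inter> V)" for n
  have cl_sup: "E n \<inter> V \<subseteq> cl n" for n
    unfolding cl_def by (intro closure_of_subset) auto
  have cl_sub: "cl n \<subseteq> V" for n
    using closure_of_subset_topspace[of mtopology] by (simp add: cl_def)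
  have "(\<Union>n. cl n) = V"
  proof
    show "V \<subseteq> (\<Union>n. cl n)"
    proof
      fix f assume "f \<in> V"
      with cover obtain n where "f \<in> E n \<inter> V"
        by blast
      then show "f \<in> (\<Union>n. cl n)"
        using cl_sup by blast
    qed
  qed (use cl_sub in blast)
  moreover have "mtopology interior_of V \<noteq> {}"
    using zero_mem interior_of_topspace[of mtopology] by auto
  moreover have "closedin mtopology (cl n)" for n
    by (simp add: cl_def)
  ultimately obtain n where "mtopology interior_of (cl n) \<noteq> {}"
    using metric_Baire_category_alt[OF \<open>mcomplete\<close>, of "range cl"] by auto
  then obtain a r where a: "a \<in> V" "0 < r"
    and sub: "mball a r \<subseteq> cl n"
    by (auto simp: metric_interior_of)
  have "\<exists>g\<in>E n \<inter> V. N (\<lambda>x. f x - g x) < e"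
    if f: "f \<in> V" "N (\<lambda>x. f x - a x) < r" and e: "0 < e" for f e
  proof -
    have "f \<in> mball a r"
      using f a N_diff_commute[OF f(1) a(1)] by (simp add: d_def)
    with sub e show ?thesis
      by (force simp: cl_def metric_closure_of d_def)
  qed
  with a show ?thesis
    by blast
qed

end

text \<open>The open mapping theorem for the identity map. Some sublevel set of \<open>N\<close> is \<open>M\<close>-dense in a
  ball about \<open>0\<close>. The remainders of the successive approximations of an element of that ball are
  Cauchy for \<open>N\<close> and tend to \<open>0\<close> for \<open>M\<close>, hence also for \<open>N\<close>.\<close>

lemma comparable_complete_norms_equivalent:
  assumes sub: "function_subspace V"
    and M: "norm_on V M" "complete_on V M" and N: "norm_on V N" "complete_on V N"
    and MN: "\<And>f. f \<in> V \<Longrightarrow> M f \<le> N f"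
  shows "\<exists>C. \<forall>f\<in>V. N f \<le> C * M f"
proof -
  interpret M: normed_function_space V M
    using sub M by unfold_locales
  interpret N: normed_function_space V N
    using sub N by unfold_locales
  have "\<exists>n::nat. f \<in> {f. N f \<le> real n}" for f
    using real_arch_simple by simp
  from M.countable_cover_somewhere_dense[OF M(2), of "\<lambda>n. {f. N f \<le> real n}", OF this]
  obtain n a r where a: "a \<in> V" and r: "0 < r"
    and dense': "\<forall>f\<in>V. M (\<lambda>x. f x - a x) < r \<longrightarrow>
      (\<forall>e>0. \<exists>g\<in>{f. N f \<le> real n} \<inter> V. M (\<lambda>x. f x - g x) < e)"
    by (elim exE conjE)
  have dense: "\<exists>g\<in>V. N g \<le> real n \<and> M (\<lambda>x. f x - g x) < e"
    if "f \<in> V" "M (\<lambda>x. f x - a x) < r" "0 < e" for f e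
    using dense'[rule_format, OF that] by blast
  define c where "c = real n"
  have c: "0 \<le> c"
    by (simp add: c_def)
  \<comment> \<open>The ball can be moved to the origin, the sublevel set being symmetric and convex.\<close>
  have dense0: "\<exists>g\<in>V. N g \<le> c \<and> M (\<lambda>x. z x - g x) < e"
    if z: "z \<in> V" "M z < r" and e: "0 < e" for z e
  proof -
    have "M (\<lambda>x. (a x + z x) - a x) < r"
      using z by simp
    then obtain g where g: "g \<in> V" "N g \<le> c" "M (\<lambda>x. (a x + z x) - g x) < e"
      using dense[OF M.add_mem[OF a z(1)] _ e] c_def by blast
    have "M (\<lambda>x. (a x - z x) - a x) < r"
      using z M.N_scale[OF z(1), of "-1"] by simp
    then obtain h where h: "h \<in> V" "N h \<le> c" "M (\<lambda>x. (a x - z x) - h x) < e"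
      using dense[OF M.diff_mem[OF a z(1)] _ e] c_def by blast
    let ?k = "\<lambda>x. (1/2) * (g x - h x)"
    have mem: "(\<lambda>x. (a x + z x) - g x) \<in> V" "(\<lambda>x. (a x - z x) - h x) \<in> V"
      by (intro M.diff_mem M.add_mem a z(1) g(1) h(1))+
    have "?k \<in> V"
      by (intro M.scale_mem M.diff_mem g h)
    moreover have "N ?k \<le> c"
      using N.N_scale[OF M.diff_mem[OF g(1) h(1)], of "1/2"] N.N_diff_le[OF g(1) h(1)] g h
      by simp
    moreover have "M (\<lambda>x. z x - ?k x) < e"
    proof -
      have "(\<lambda>x. z x - ?k x) = (\<lambda>x. (1/2) * (((a x + z x) - g x) - ((a x - z x) - h x)))"
        by (auto simp: fun_eq_iff field_simps)
      then show ?thesis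
        using M.N_scale[OF M.diff_mem[OF mem], of "1/2"] M.N_diff_le[OF mem] g(3) h(3) by simp
    qed
    ultimately show ?thesis
      by blast
  qed
  \<comment> \<open>One approximation step: \<open>w\<close> is the remainder of the approximation of \<open>z\<close>.\<close>
  have step: "\<exists>w\<in>V. M w < r / 2 ^ Suc j \<and> N (\<lambda>x. z x - w x) \<le> c / 2 ^ j"
    if z: "z \<in> V" "M z < r / 2 ^ j" for z j
  proof -
    have "M (\<lambda>x. 2 ^ j * z x) < r"
      using z M.N_scale[OF z(1), of "2 ^ j"] by (simp add: field_simps)
    from dense0[OF M.scale_mem[OF z(1)] this, of "r / 2"] r
    obtain g where g: "g \<in> V" "N g \<le> c" "M (\<lambda>x. 2 ^ j * z x - g x) < r / 2"
      by auto
    let ?w = "\<lambda>x. (1 / 2 ^ j) * (2 ^ j * z x - g x)"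
    have mem: "(\<lambda>x. 2 ^ j * z x - g x) \<in> V"
      by (intro M.diff_mem M.scale_mem z g)
    have "M ?w < r / 2 ^ Suc j"
      using M.N_scale[OF mem, of "1 / 2 ^ j"] g(3) by (simp add: field_simps)
    moreover have "(\<lambda>x. z x - ?w x) = (\<lambda>x. (1 / 2 ^ j) * g x)"
      by (auto simp: fun_eq_iff field_simps)
    then have "N (\<lambda>x. z x - ?w x) \<le> c / 2 ^ j"
      using N.N_scale[OF g(1), of "1 / 2 ^ j"] g(2) by (simp add: field_simps)
    ultimately show ?thesis
      using M.scale_mem[OF mem] by blast
  qed
  have ball: "N z \<le> 2 * c" if z: "z \<in> V" "M z < r" for z
  proof -
    have "\<exists>R. \<forall>j. (R j \<in> V \<and> M (R j) < r / 2 ^ j \<and> (j = 0 \<longrightarrow> R j = z)) \<and>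
        N (\<lambda>x. R j x - R (Suc j) x) \<le> c / 2 ^ j"
      using z step by (intro dependent_nat_choice) auto
    then obtain R where R: "\<And>j. R j \<in> V" "\<And>j. M (R j) < r / 2 ^ j" "R 0 = z"
      and Rstep: "\<And>j. N (\<lambda>x. R j x - R (Suc j) x) \<le> c / 2 ^ j"
      by blast
    have tail: "N (\<lambda>x. R j x - R (j + m) x) \<le> 2 * c / 2 ^ j - 2 * c / 2 ^ (j + m)" for j m
    proof (induction m)
      case 0
      show ?case
        using N.N_eq_0[OF M.zero_mem] by simp
    next
      case (Suc m)
      have "N (\<lambda>x. R j x - R (j + Suc m) x) \<le>
          N (\<lambda>x. R j x - R (j + m) x) + N (\<lambda>x. R (j + m) x - R (j + Suc m) x)"
        by (intro N.N_diff_triangle R)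
      also have "\<dots> \<le> (2 * c / 2 ^ j - 2 * c / 2 ^ (j + m)) + c / 2 ^ (j + m)"
        using Suc.IH Rstep[of "j + m"] by simp
      finally show ?case
        by (simp add: field_simps)
    qed
    have tail': "N (\<lambda>x. R j x - R i x) \<le> 2 * c / 2 ^ j" if "j \<le> i" for i j
    proof -
      have "0 \<le> 2 * c / 2 ^ i"
        using c by simp
      then show ?thesis
        using tail[of j "i - j"] that by simp
    qed
    have "(\<lambda>j. 2 * c / 2 ^ j) \<longlonglongrightarrow> 0"
      by (rule LIMSEQ_divide_realpow_zero) simp
    then have small: "\<exists>j0. \<forall>j\<ge>j0. 2 * c / 2 ^ j < e" if "0 < e" for e
      using order_tendstoD(2) that unfolding eventually_sequentially[symmetric] by blast
    have "\<forall>e>0. \<exists>n0. \<forall>m\<ge>n0. \<forall>n\<ge>n0. N (\<lambda>x. R m x - R n x) < e"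
    proof (intro allI impI)
      fix e :: real assume "0 < e"
      then obtain n0 where n0: "\<And>j. j \<ge> n0 \<Longrightarrow> 2 * c / 2 ^ j < e"
        using small by blast
      have "N (\<lambda>x. R m x - R n x) < e" if "m \<ge> n0" "n \<ge> n0" for m n
      proof (cases "m \<le> n")
        case True
        then show ?thesis using tail' n0 that by (meson le_less_trans)
      next
        case False
        then have "N (\<lambda>x. R n x - R m x) < e"
          using tail'[of n m] n0[of n] that by simp
        then show ?thesis
          using N.N_diff_commute[OF R(1) R(1)] by metis
      qed
      then show "\<exists>n0. \<forall>m\<ge>n0. \<forall>n\<ge>n0. N (\<lambda>x. R m x - R n x) < e"
        by blast
    qed
    then obtain f where f: "f \<in> V" and lim: "(\<lambda>j. N (\<lambda>x. R j x - f x)) \<longlonglongrightarrow> 0"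
      using N(2) R(1) unfolding complete_on_def by blast
    have "M f \<le> N (\<lambda>x. R j x - f x) + r / 2 ^ j" for j
      using M.N_le_diff[OF f R(1)[of j]] M.N_diff_commute[OF f R(1)[of j]] R(2)[of j]
        MN[OF M.diff_mem[OF R(1)[of j] f]] by simp
    moreover have "(\<lambda>j. N (\<lambda>x. R j x - f x) + r / 2 ^ j) \<longlonglongrightarrow> 0 + 0"
      by (intro tendsto_add lim LIMSEQ_divide_realpow_zero) simp
    ultimately have "M f \<le> 0"
      by (intro LIMSEQ_le_const[where X = "\<lambda>j. N (\<lambda>x. R j x - f x) + r / 2 ^ j"]) auto
    then have "f = (\<lambda>x. 0)"
      using M.N_nonneg[OF f] M.N_eq_0[OF f] by simp
    with lim have lim0: "(\<lambda>j. N (R j)) \<longlonglongrightarrow> 0"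
      by simp
    have "N z \<le> 2 * c + N (R j)" for j
      using N.N_le_diff[OF z(1) R(1)[of j]] tail'[of 0 j] R(3) by simp
    moreover have "(\<lambda>j. 2 * c + N (R j)) \<longlonglongrightarrow> 2 * c + 0"
      by (intro tendsto_intros lim0)
    ultimately show ?thesis
      by (intro LIMSEQ_le_const[where X = "\<lambda>j. 2 * c + N (R j)"]) auto
  qed
  have "N f \<le> (4 * c / r) * M f" if f: "f \<in> V" for f
  proof (cases "M f = 0")
    case True
    then show ?thesis
      using M.N_eq_0[OF f] N.N_eq_0[OF f] by simp
  next
    case False
    then have Mf: "0 < M f"
      using M.N_nonneg[OF f] by simp
    \<comment> \<open>The factor \<open>2\<close> puts the rescaled function strictly inside the open ball.\<close>
    let ?s = "r / (2 * M f)"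
    have "0 < ?s"
      using Mf r by simp
    then have "M (\<lambda>x. ?s * f x) < r"
      using M.N_scale[OF f, of ?s] Mf r by simp
    then have "N (\<lambda>x. ?s * f x) \<le> 2 * c"
      by (intro ball M.scale_mem f)
    then have "?s * N f \<le> 2 * c"
      using N.N_scale[OF f, of ?s] abs_of_pos[OF \<open>0 < ?s\<close>] by metis
    then show ?thesis
      using Mf r by (simp add: field_simps)
  qed
  then show ?thesis
    by blast
qed

lemma (in normed_function_space) tendsto_eval:
  assumes eval: "\<exists>C. \<forall>f\<in>V. \<bar>f x\<bar> \<le> C * N f"
    and u: "eventually (\<lambda>n. u n \<in> V) G" and f: "f \<in> V"
    and lim: "((\<lambda>n. N (\<lambda>x. u n x - f x)) \<longlongrightarrow> 0) G"
  shows "((\<lambda>n. u n x) \<longlongrightarrow> f x) G"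
proof -
  obtain C where C: "\<And>f. f \<in> V \<Longrightarrow> \<bar>f x\<bar> \<le> C * N f"
    using eval by blast
  have "((\<lambda>n. u n x - f x) \<longlongrightarrow> 0) G"
  proof (rule Lim_null_comparison)
    show "eventually (\<lambda>n. norm (u n x - f x) \<le> C * N (\<lambda>x. u n x - f x)) G"
      using u by eventually_elim (use C[OF diff_mem[OF _ f]] in simp)
    show "((\<lambda>n. C * N (\<lambda>x. u n x - f x)) \<longlongrightarrow> 0) G"
      using tendsto_mult_right_zero[OF lim] .
  qed
  then show ?thesis
    by (simp add: LIM_zero_iff)
qed

text \<open>A form of the closed graph theorem: the limits in the two norms agree because both
  determine the pointwise limit, so the sum of the norms is complete.\<close>

lemma inclusion_bounded:
  assumes V: "normed_function_space V M" "complete_on V M"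
    and W: "normed_function_space W N" "complete_on W N"
    and VW: "V \<subseteq> W"
    and evalV: "\<And>x. \<exists>C. \<forall>f\<in>V. \<bar>f x\<bar> \<le> C * M f"
    and evalW: "\<And>x. \<exists>C. \<forall>f\<in>W. \<bar>f x\<bar> \<le> C * N f"
  shows "\<exists>C. \<forall>f\<in>V. N f \<le> C * M f"
proof -
  interpret V: normed_function_space V M by fact
  interpret W: normed_function_space W N by fact
  define p where "p f = M f + N f" for f
  have le_p: "M f \<le> p f" "N f \<le> p f" if "f \<in> V" for f
    using that V.N_nonneg W.N_nonneg VW by (auto simp: p_def)
  have "norm_on V p"
    unfolding norm_on_def
  proof (intro conjI ballI allI)
    fix f assume f: "f \<in> V"
    then have fW: "f \<in> W"
      using VW by blast
    show "0 \<le> p f"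
      using V.N_nonneg[OF f] W.N_nonneg[OF fW] by (simp add: p_def)
    show "p f = 0 \<longleftrightarrow> f = (\<lambda>x. 0)"
      using V.N_nonneg[OF f] W.N_nonneg[OF fW] V.N_eq_0[OF f] W.N_eq_0[OF fW]
      by (auto simp: p_def add_nonneg_eq_0_iff)
    show "p (\<lambda>x. c * f x) = \<bar>c\<bar> * p f" for c
      using V.N_scale[OF f] W.N_scale[OF fW] by (simp add: p_def distrib_left)
    show "p (\<lambda>x. f x + g x) \<le> p f + p g" if g: "g \<in> V" for g
      using V.N_triangle[OF f g] W.N_triangle[OF fW, of g] g VW by (force simp: p_def)
  qed
  moreover have "complete_on V p"
    unfolding complete_on_def
  proof (intro allI impI)
    fix u :: "nat \<Rightarrow> 'a \<Rightarrow> real"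
    assume u: "\<forall>n. u n \<in> V"
      and cauchy: "\<forall>e>0. \<exists>n0. \<forall>m\<ge>n0. \<forall>n\<ge>n0. p (\<lambda>x. u m x - u n x) < e"
    have uW: "u n \<in> W" for n
      using u VW by blast
    have diff: "(\<lambda>x. u m x - u n x) \<in> V" for m n
      using u V.diff_mem by blast
    have "\<forall>e>0. \<exists>n0. \<forall>m\<ge>n0. \<forall>n\<ge>n0. M (\<lambda>x. u m x - u n x) < e"
      using cauchy le_p(1)[OF diff] by (meson le_less_trans)
    then obtain f where f: "f \<in> V" and Mlim: "(\<lambda>n. M (\<lambda>x. u n x - f x)) \<longlonglongrightarrow> 0"
      using V(2) u unfolding complete_on_def by blast
    have "\<forall>e>0. \<exists>n0. \<forall>m\<ge>n0. \<forall>n\<ge>n0. N (\<lambda>x. u m x - u n x) < e"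
      using cauchy le_p(2)[OF diff] by (meson le_less_trans)
    then obtain g where g: "g \<in> W" and Nlim: "(\<lambda>n. N (\<lambda>x. u n x - g x)) \<longlonglongrightarrow> 0"
      using W(2) uW unfolding complete_on_def by blast
    have "f x = g x" for x
    proof (rule LIMSEQ_unique)
      show "(\<lambda>n. u n x) \<longlonglongrightarrow> f x"
        by (rule V.tendsto_eval) (use evalV u f Mlim in auto)
      show "(\<lambda>n. u n x) \<longlonglongrightarrow> g x"
        by (rule W.tendsto_eval) (use evalW uW g Nlim in auto)
    qed
    then have "f = g"
      by auto
    then have "(\<lambda>n. p (\<lambda>x. u n x - f x)) \<longlonglongrightarrow> 0"
      using tendsto_add[OF Mlim Nlim] by (simp add: p_def)
    with f show "\<exists>f\<in>V. (\<lambda>n. p (\<lambda>x. u n x - f x)) \<longlonglongrightarrow> 0"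
      by blast
  qed
  ultimately obtain C where "\<forall>f\<in>V. p f \<le> C * M f"
    using comparable_complete_norms_equivalent[OF V.subspace V.norm V(2), of p] le_p by blast
  then show ?thesis
    using le_p by (meson order_trans)
qed

text \<open>Linear functionals on the carrier \<open>V\<close>, without any continuity; the values of \<open>L\<close> off
  \<open>V\<close> are arbitrary.\<close>

definition linear_functional_on :: "('s \<Rightarrow> real) set \<Rightarrow> (('s \<Rightarrow> real) \<Rightarrow> real) \<Rightarrow> bool" where
  "linear_functional_on V L \<longleftrightarrow>
     (\<forall>f\<in>V. \<forall>g\<in>V. L (\<lambda>x. f x + g x) = L f + L g) \<and>
     (\<forall>c. \<forall>f\<in>V. L (\<lambda>x. c * f x) = c * L f)"

lemma (in function_space) linear_functional_diff:
  assumes "linear_functional_on V L" "f \<in> V" "g \<in> V"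
  shows "L (\<lambda>x. f x - g x) = L f - L g"
  using assms(1)[unfolded linear_functional_on_def,
    THEN conjunct1, rule_format, OF assms(2) scale_mem[OF assms(3), of "-1"]]
    assms(1)[unfolded linear_functional_on_def, THEN conjunct2, rule_format, OF assms(3), of "-1"]
  by simp

text \<open>The Banach--Steinhaus theorem for functionals. The sum of \<open>M\<close> and the seminorm
  \<open>f \<mapsto> SUP n. \<bar>u n f\<bar>\<close> is a complete norm above \<open>M\<close>.\<close>

lemma pointwise_bounded_functionals_uniformly_bounded:
  assumes V: "normed_function_space V M" "complete_on V M"
    and lin: "\<And>n::nat. linear_functional_on V (u n)"
    and bounded: "\<And>n. \<exists>C. \<forall>f\<in>V. \<bar>u n f\<bar> \<le> C * M f"
    and pointwise: "\<And>f. f \<in> V \<Longrightarrow> bdd_above (range (\<lambda>n. \<bar>u n f\<bar>))"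
  shows "\<exists>C. \<forall>n. \<forall>f\<in>V. \<bar>u n f\<bar> \<le> C * M f"
proof -
  interpret V: normed_function_space V M by fact
  define q where "q f = (SUP n. \<bar>u n f\<bar>)" for f
  define p where "p f = M f + q f" for f
  have u_le: "\<bar>u n f\<bar> \<le> q f" if "f \<in> V" for n f
    unfolding q_def using pointwise[OF that] by (intro cSUP_upper) auto
  have q_le: "q f \<le> b" if "\<And>n. \<bar>u n f\<bar> \<le> b" for f b
    unfolding q_def using that by (intro cSUP_least) auto
  have q_nonneg: "0 \<le> q f" if "f \<in> V" for f
    using u_le[OF that, of 0] by simp
  have le_p: "M f \<le> p f" "\<bar>u n f\<bar> \<le> p f" if "f \<in> V" for f n
    using V.N_nonneg[OF that] q_nonneg[OF that] u_le[OF that, of n] by (auto simp: p_def)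
  have u_scale: "u n (\<lambda>x. c * f x) = c * u n f" if "f \<in> V" for n c f
    using lin[of n] that by (simp add: linear_functional_on_def)
  have u_add: "u n (\<lambda>x. f x + g x) = u n f + u n g" if "f \<in> V" "g \<in> V" for n f g
    using lin[of n] that by (simp add: linear_functional_on_def)
  have q_scale_le: "q (\<lambda>x. c * f x) \<le> \<bar>c\<bar> * q f" if "f \<in> V" for c f
    using u_le[OF that] u_scale[OF that] by (intro q_le) (simp add: abs_mult mult_left_mono)
  have q_scale: "q (\<lambda>x. c * f x) = \<bar>c\<bar> * q f" if f: "f \<in> V" for c f
  proof (cases "c = 0")
    case True
    then show ?thesis
      using q_scale_le[OF f, of 0] q_nonneg[OF V.zero_mem] by simp
  next
    case False
    have "q f \<le> \<bar>1 / c\<bar> * q (\<lambda>x. c * f x)"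
      using q_scale_le[OF V.scale_mem[OF f], of "1 / c" c] False by simp
    then have "\<bar>c\<bar> * q f \<le> q (\<lambda>x. c * f x)"
      using False by (simp add: field_simps)
    then show ?thesis
      using q_scale_le[OF f, of c] by simp
  qed
  have q_triangle: "q (\<lambda>x. f x + g x) \<le> q f + q g" if "f \<in> V" "g \<in> V" for f g
  proof (rule q_le)
    fix n
    show "\<bar>u n (\<lambda>x. f x + g x)\<bar> \<le> q f + q g"
      using u_le[OF that(1), of n] u_le[OF that(2), of n] u_add[OF that, of n] by simp
  qed
  have "norm_on V p"
    unfolding norm_on_def
  proof (intro conjI ballI allI)
    fix f assume f: "f \<in> V"
    show "0 \<le> p f"
      using V.N_nonneg[OF f] q_nonneg[OF f] by (simp add: p_def)
    show "p f = 0 \<longleftrightarrow> f = (\<lambda>x. 0)"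
      using V.N_nonneg[OF f] q_nonneg[OF f] V.N_eq_0[OF f] q_scale[OF V.zero_mem, of 0]
      by (auto simp: p_def add_nonneg_eq_0_iff)
    show "p (\<lambda>x. c * f x) = \<bar>c\<bar> * p f" for c
      using V.N_scale[OF f] q_scale[OF f] by (simp add: p_def distrib_left)
    show "p (\<lambda>x. f x + g x) \<le> p f + p g" if g: "g \<in> V" for g
      using V.N_triangle[OF f g] q_triangle[OF f g] by (simp add: p_def)
  qed
  moreover have "complete_on V p"
    unfolding complete_on_def
  proof (intro allI impI)
    fix v :: "nat \<Rightarrow> 'a \<Rightarrow> real"
    assume "\<forall>n. v n \<in> V"
      and cauchy: "\<forall>e>0. \<exists>n0. \<forall>m\<ge>n0. \<forall>n\<ge>n0. p (\<lambda>x. v m x - v n x) < e"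
    then have v: "v n \<in> V" for n
      by blast
    have diff: "(\<lambda>x. v m x - v n x) \<in> V" for m n
      using v V.diff_mem by blast
    have "\<forall>e>0. \<exists>n0. \<forall>m\<ge>n0. \<forall>n\<ge>n0. M (\<lambda>x. v m x - v n x) < e"
      using cauchy le_p(1)[OF diff] by (meson le_less_trans)
    then obtain f where f: "f \<in> V" and Mlim: "(\<lambda>n. M (\<lambda>x. v n x - f x)) \<longlonglongrightarrow> 0"
      using V(2) v unfolding complete_on_def by blast
    have u_lim: "(\<lambda>j. u n (v j)) \<longlonglongrightarrow> u n f" for n
    proof -
      obtain C where C: "\<And>f. f \<in> V \<Longrightarrow> \<bar>u n f\<bar> \<le> C * M f"
        using bounded by blast
      have "(\<lambda>j. u n (v j) - u n f) \<longlonglongrightarrow> 0"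
      proof (rule Lim_null_comparison)
        show "eventually (\<lambda>j. norm (u n (v j) - u n f) \<le> C * M (\<lambda>x. v j x - f x)) sequentially"
          using C[OF V.diff_mem[OF v f]] V.linear_functional_diff[OF lin v f] by simp
        show "(\<lambda>j. C * M (\<lambda>x. v j x - f x)) \<longlonglongrightarrow> 0"
          using tendsto_mult_right_zero[OF Mlim] .
      qed
      then show ?thesis
        by (simp add: LIM_zero_iff)
    qed
    have "(\<lambda>i. q (\<lambda>x. v i x - f x)) \<longlonglongrightarrow> 0"
    proof (rule LIMSEQ_I)
      fix e :: real assume "0 < e"
      then obtain n0 where n0: "\<And>i j. i \<ge> n0 \<Longrightarrow> j \<ge> n0 \<Longrightarrow> p (\<lambda>x. v i x - v j x) < e / 2"
        using cauchy by (metis half_gt_zero)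
      have "q (\<lambda>x. v i x - f x) \<le> e / 2" if "i \<ge> n0" for i
      proof (rule q_le)
        fix n
        have "\<bar>u n (v i) - u n (v j)\<bar> \<le> e / 2" if "j \<ge> n0" for j
          using le_p(2)[OF diff[of i j], of n] n0[OF \<open>i \<ge> n0\<close> that]
            V.linear_functional_diff[OF lin v v, of n i j] by simp
        moreover have "(\<lambda>j. \<bar>u n (v i) - u n (v j)\<bar>) \<longlonglongrightarrow> \<bar>u n (v i) - u n f\<bar>"
          by (intro tendsto_intros u_lim)
        ultimately have "\<bar>u n (v i) - u n f\<bar> \<le> e / 2"
          by (intro LIMSEQ_le_const2) auto
        then show "\<bar>u n (\<lambda>x. v i x - f x)\<bar> \<le> e / 2"
          using V.linear_functional_diff[OF lin v f] by simp
      qed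
      then have "norm (q (\<lambda>x. v i x - f x) - 0) < e" if "i \<ge> n0" for i
        using that q_nonneg[OF V.diff_mem[OF v[of i] f]] \<open>0 < e\<close> by fastforce
      then show "\<exists>n0. \<forall>i\<ge>n0. norm (q (\<lambda>x. v i x - f x) - 0) < e"
        by blast
    qed
    from tendsto_add[OF Mlim this] f show "\<exists>f\<in>V. (\<lambda>n. p (\<lambda>x. v n x - f x)) \<longlonglongrightarrow> 0"
      by (auto simp: p_def)
  qed
  ultimately obtain C where "\<forall>f\<in>V. p f \<le> C * M f"
    using comparable_complete_norms_equivalent[OF V.subspace V.norm V(2), of p] le_p by blast
  then show ?thesis
    using le_p by (meson order_trans)
qed

corollary pointwise_limit_of_functionals_bounded:
  assumes V: "normed_function_space V M" "complete_on V M"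
    and lin: "\<And>n::nat. linear_functional_on V (u n)"
    and bounded: "\<And>n. \<exists>C. \<forall>f\<in>V. \<bar>u n f\<bar> \<le> C * M f"
    and lim: "\<And>f. f \<in> V \<Longrightarrow> (\<lambda>n. u n f) \<longlonglongrightarrow> L f"
  shows "\<exists>C. \<forall>f\<in>V. \<bar>L f\<bar> \<le> C * M f"
proof -
  have "bdd_above (range (\<lambda>n. \<bar>u n f\<bar>))" if "f \<in> V" for f
    using convergent_imp_bounded[OF lim[OF that]]
    by (auto simp: bounded_iff bdd_above_def)
  then obtain C where C: "\<And>n f. f \<in> V \<Longrightarrow> \<bar>u n f\<bar> \<le> C * M f"
    using pointwise_bounded_functionals_uniformly_bounded[of V M u, OF V lin bounded]
    by blast
  have "\<bar>L f\<bar> \<le> C * M f" if "f \<in> V" for f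
    using C[OF that] tendsto_rabs[OF lim[OF that]] by (intro LIMSEQ_le_const2) auto
  then show ?thesis
    by blast
qed

section \<open>Hilbert spaces of functions\<close>

locale inner_function_space = function_space V
  for V :: "('s \<Rightarrow> real) set" +
  fixes ip :: "('s \<Rightarrow> real) \<Rightarrow> ('s \<Rightarrow> real) \<Rightarrow> real"
  assumes inner: "inner_product_on V ip"
begin

lemma ip_commute: "f \<in> V \<Longrightarrow> g \<in> V \<Longrightarrow> ip f g = ip g f"
  and ip_add_left:
    "f \<in> V \<Longrightarrow> g \<in> V \<Longrightarrow> h \<in> V \<Longrightarrow> ip (\<lambda>x. f x + g x) h = ip f h + ip g h"
  and ip_scale_left: "f \<in> V \<Longrightarrow> h \<in> V \<Longrightarrow> ip (\<lambda>x. c * f x) h = c * ip f h"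
  and ip_nonneg: "f \<in> V \<Longrightarrow> 0 \<le> ip f f"
  and ip_eq_0: "f \<in> V \<Longrightarrow> ip f f = 0 \<longleftrightarrow> f = (\<lambda>x. 0)"
  using inner unfolding inner_product_on_def by blast+

lemma ip_linear_left: "h \<in> V \<Longrightarrow> linear_functional_on V (\<lambda>f. ip f h)"
  by (simp add: linear_functional_on_def ip_add_left ip_scale_left)

lemma ip_diff_left:
  "f \<in> V \<Longrightarrow> g \<in> V \<Longrightarrow> h \<in> V \<Longrightarrow> ip (\<lambda>x. f x - g x) h = ip f h - ip g h"
  using linear_functional_diff[OF ip_linear_left] .

lemma ip_add_right:
  "f \<in> V \<Longrightarrow> g \<in> V \<Longrightarrow> h \<in> V \<Longrightarrow> ip h (\<lambda>x. f x + g x) = ip h f + ip h g"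
  and ip_scale_right: "f \<in> V \<Longrightarrow> h \<in> V \<Longrightarrow> ip h (\<lambda>x. c * f x) = c * ip h f"
  and ip_diff_right:
  "f \<in> V \<Longrightarrow> g \<in> V \<Longrightarrow> h \<in> V \<Longrightarrow> ip h (\<lambda>x. f x - g x) = ip h f - ip h g"
  by (simp_all add: ip_commute[of h] add_mem scale_mem diff_mem ip_add_left ip_scale_left
      ip_diff_left)

lemma ip_zero_left: "h \<in> V \<Longrightarrow> ip (\<lambda>x. 0) h = 0"
  using ip_scale_left[OF zero_mem, of h 0] by simp

lemma ip_sum_left:
  assumes "finite A" "\<And>i. i \<in> A \<Longrightarrow> \<phi> i \<in> V" "h \<in> V"
  shows "(\<lambda>x. \<Sum>i\<in>A. c i * \<phi> i x) \<in> V \<and>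
    ip (\<lambda>x. \<Sum>i\<in>A. c i * \<phi> i x) h = (\<Sum>i\<in>A. c i * ip (\<phi> i) h)"
  using assms
  by (induction A) (auto simp: zero_mem ip_zero_left add_mem scale_mem ip_add_left ip_scale_left)

lemma norm_square_add_scale:
  assumes "f \<in> V" "g \<in> V"
  shows "ip (\<lambda>x. f x + t * g x) (\<lambda>x. f x + t * g x) = ip f f + 2 * t * ip f g + t\<^sup>2 * ip g g"
  using assms
  by (simp add: ip_add_left ip_add_right ip_scale_left ip_scale_right add_mem scale_mem
      ip_commute[of g f] power2_eq_square algebra_simps)

lemma Cauchy_Schwarz:
  assumes f: "f \<in> V" and g: "g \<in> V"
  shows "\<bar>ip f g\<bar> \<le> sqrt (ip f f) * sqrt (ip g g)"
proof (cases "ip g g = 0")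
  case True
  then show ?thesis
    using ip_eq_0[OF g] ip_commute[OF f g] ip_zero_left[OF f] by simp
next
  case False
  then have pos: "0 < ip g g"
    using ip_nonneg[OF g] by simp
  have "0 \<le> ip f f + 2 * (- ip f g / ip g g) * ip f g + (- ip f g / ip g g)\<^sup>2 * ip g g"
    using ip_nonneg[OF add_mem[OF f scale_mem[OF g]]] norm_square_add_scale[OF f g] by metis
  also have "\<dots> = ip f f - (ip f g)\<^sup>2 / ip g g"
    using pos by (simp add: power2_eq_square)
  finally have "(ip f g)\<^sup>2 \<le> ip f f * ip g g"
    using pos by (simp add: field_simps)
  then have "sqrt ((ip f g)\<^sup>2) \<le> sqrt (ip f f * ip g g)"
    by (rule real_sqrt_le_mono)
  then show ?thesis
    by (simp add: real_sqrt_mult)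
qed

lemma norm_on_sqrt: "norm_on V (\<lambda>f. sqrt (ip f f))"
  unfolding norm_on_def
proof (intro conjI ballI allI)
  fix f assume f: "f \<in> V"
  show "0 \<le> sqrt (ip f f)" "sqrt (ip f f) = 0 \<longleftrightarrow> f = (\<lambda>x. 0)"
    using ip_nonneg[OF f] ip_eq_0[OF f] by simp_all
  show "sqrt (ip (\<lambda>x. c * f x) (\<lambda>x. c * f x)) = \<bar>c\<bar> * sqrt (ip f f)" for c
    using f by (simp add: ip_scale_left ip_scale_right scale_mem real_sqrt_mult
        flip: mult.assoc)
  show "sqrt (ip (\<lambda>x. f x + g x) (\<lambda>x. f x + g x)) \<le> sqrt (ip f f) + sqrt (ip g g)"
    if g: "g \<in> V" for g
  proof (rule real_le_lsqrt)
    show "0 \<le> sqrt (ip f f) + sqrt (ip g g)"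
      using ip_nonneg f g by simp
    have "ip (\<lambda>x. f x + g x) (\<lambda>x. f x + g x) = ip f f + 2 * ip f g + ip g g"
      using norm_square_add_scale[OF f g, of 1] by simp
    also have "\<dots> \<le> ip f f + 2 * (sqrt (ip f f) * sqrt (ip g g)) + ip g g"
      using Cauchy_Schwarz[OF f g] by simp
    also have "\<dots> = (sqrt (ip f f) + sqrt (ip g g))\<^sup>2"
      using ip_nonneg f g by (simp add: power2_sum)
    finally show "ip (\<lambda>x. f x + g x) (\<lambda>x. f x + g x) \<le> (sqrt (ip f f) + sqrt (ip g g))\<^sup>2" .
  qed
qed

sublocale normed_function_space V "\<lambda>f. sqrt (ip f f)"
  by unfold_locales (rule norm_on_sqrt)

lemma tendsto_ip_left:
  assumes u: "\<And>n::nat. u n \<in> V" and f: "f \<in> V" and g: "g \<in> V"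
    and lim: "(\<lambda>n. sqrt (ip (\<lambda>x. u n x - f x) (\<lambda>x. u n x - f x))) \<longlonglongrightarrow> 0"
  shows "(\<lambda>n. ip (u n) g) \<longlonglongrightarrow> ip f g"
proof -
  have "(\<lambda>n. ip (u n) g - ip f g) \<longlonglongrightarrow> 0"
  proof (rule Lim_null_comparison)
    show "eventually (\<lambda>n. norm (ip (u n) g - ip f g) \<le>
        sqrt (ip (\<lambda>x. u n x - f x) (\<lambda>x. u n x - f x)) * sqrt (ip g g)) sequentially"
      using Cauchy_Schwarz[OF diff_mem[OF u f] g] ip_diff_left[OF u f g] by simp
    show "(\<lambda>n. sqrt (ip (\<lambda>x. u n x - f x) (\<lambda>x. u n x - f x)) * sqrt (ip g g)) \<longlonglongrightarrow> 0"
      using tendsto_mult_left_zero[OF lim] .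
  qed
  then show ?thesis
    by (simp add: LIM_zero_iff)
qed

text \<open>The Riesz representation theorem. The representing element minimises
  \<open>f \<mapsto> \<langle>f, f\<rangle> - 2 L f\<close>; minimising sequences are Cauchy by the parallelogram law.\<close>

lemma riesz_representation:
  assumes complete: "complete_on V (\<lambda>f. sqrt (ip f f))"
    and lin: "linear_functional_on V L"
    and bounded: "\<And>f. f \<in> V \<Longrightarrow> \<bar>L f\<bar> \<le> C * sqrt (ip f f)"
  shows "\<exists>\<phi>\<in>V. \<forall>f\<in>V. L f = ip f \<phi>"
proof -
  define J where "J f = ip f f - 2 * L f" for f
  have L_scale: "L (\<lambda>x. c * f x) = c * L f" if "f \<in> V" for c f
    using lin that by (simp add: linear_functional_on_def)
  have L_add: "L (\<lambda>x. f x + g x) = L f + L g" if "f \<in> V" "g \<in> V" for f g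
    using lin that by (simp add: linear_functional_on_def)
  have "- C\<^sup>2 \<le> J f" if f: "f \<in> V" for f
  proof -
    have "0 \<le> (sqrt (ip f f) - C)\<^sup>2"
      by simp
    also have "\<dots> = ip f f - 2 * (C * sqrt (ip f f)) + C\<^sup>2"
      using ip_nonneg[OF f] by (simp add: power2_diff)
    finally show ?thesis
      using bounded[OF f] by (simp add: J_def)
  qed
  then have bdd: "bdd_below (J ` V)"
    by (auto simp: bdd_below_def)
  define m where "m = Inf (J ` V)"
  have m_le: "m \<le> J f" if "f \<in> V" for f
    unfolding m_def using bdd that by (intro cInf_lower) auto
  have "\<exists>f\<in>V. J f < m + 1 / real (Suc n)" for n
    using cInf_lessD[of "J ` V" "m + 1 / real (Suc n)"] zero_mem by (auto simp: m_def)
  then obtain u where u: "\<And>n. u n \<in> V" and Ju: "\<And>n. J (u n) < m + 1 / real (Suc n)"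
    by metis
  have parallelogram: "ip (\<lambda>x. f x - g x) (\<lambda>x. f x - g x) \<le> 2 * J f + 2 * J g - 4 * m"
    if f: "f \<in> V" and g: "g \<in> V" for f g
  proof -
    let ?h = "\<lambda>x. (1/2) * (f x + 1 * g x)"
    have mem: "(\<lambda>x. f x + 1 * g x) \<in> V"
      using add_mem[OF f g] by simp
    have "ip ?h ?h = (1/4) * ip (\<lambda>x. f x + 1 * g x) (\<lambda>x. f x + 1 * g x)"
      using ip_scale_left[OF mem scale_mem[OF mem, of "1/2"], of "1/2"]
        ip_scale_right[OF mem mem, of "1/2"] by linarith
    then have "ip ?h ?h = (1/4) * (ip f f + 2 * ip f g + ip g g)"
      using norm_square_add_scale[OF f g, of 1] by simp
    moreover have "L ?h = (1/2) * (L f + L g)"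
      using L_scale[OF mem, of "1/2"] L_add[OF f g] by simp
    moreover have "m \<le> J ?h"
      using m_le[OF scale_mem[OF mem]] .
    moreover have "ip (\<lambda>x. f x - g x) (\<lambda>x. f x - g x) = ip f f - 2 * ip f g + ip g g"
      using norm_square_add_scale[OF f g, of "-1"] by simp
    ultimately show ?thesis
      by (simp add: J_def)
  qed
  have "\<forall>e>0. \<exists>n0. \<forall>i\<ge>n0. \<forall>j\<ge>n0. sqrt (ip (\<lambda>x. u i x - u j x) (\<lambda>x. u i x - u j x)) < e"
  proof (intro allI impI)
    fix e :: real assume e: "0 < e"
    then obtain n0 where n0: "1 / real (Suc n0) < e\<^sup>2 / 4"
      using nat_approx_posE[of "e\<^sup>2 / 4"] by auto
    have "sqrt (ip (\<lambda>x. u i x - u j x) (\<lambda>x. u i x - u j x)) < e" if "i \<ge> n0" "j \<ge> n0" for i j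
    proof -
      have "1 / real (Suc i) \<le> 1 / real (Suc n0)" "1 / real (Suc j) \<le> 1 / real (Suc n0)"
        using that by (simp_all add: frac_le)
      then have "ip (\<lambda>x. u i x - u j x) (\<lambda>x. u i x - u j x) < e\<^sup>2"
        using parallelogram[OF u u, of i j] Ju[of i] Ju[of j] n0 by linarith
      then show ?thesis
        using e by (simp add: real_less_lsqrt)
    qed
    then show "\<exists>n0. \<forall>i\<ge>n0. \<forall>j\<ge>n0. sqrt (ip (\<lambda>x. u i x - u j x) (\<lambda>x. u i x - u j x)) < e"
      by blast
  qed
  then obtain \<phi> where \<phi>: "\<phi> \<in> V"
    and lim: "(\<lambda>n. sqrt (ip (\<lambda>x. u n x - \<phi> x) (\<lambda>x. u n x - \<phi> x))) \<longlonglongrightarrow> 0"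
    using complete u unfolding complete_on_def by blast
  have "L g = ip g \<phi>" if g: "g \<in> V" for g
  proof -
    define a where "a = ip \<phi> g - L g"
    define b where "b = ip g g"
    \<comment> \<open>First-order condition at the minimum.\<close>
    have var: "0 \<le> 2 * t * a + t\<^sup>2 * b" for t
    proof -
      have "0 \<le> 2 * t * (ip (u n) g - L g) + t\<^sup>2 * b + 1 / real (Suc n)" for n
        using m_le[OF add_mem[OF u scale_mem[OF g]], of n t] Ju[of n]
          norm_square_add_scale[OF u g, of n t] L_add[OF u scale_mem[OF g], of n t]
          L_scale[OF g, of t]
        by (simp add: J_def b_def algebra_simps)
      moreover have "(\<lambda>n. 2 * t * (ip (u n) g - L g) + t\<^sup>2 * b + 1 / real (Suc n))
          \<longlonglongrightarrow> 2 * t * a + t\<^sup>2 * b + 0"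
        unfolding a_def
        by (intro tendsto_intros tendsto_ip_left[OF u \<phi> g lim]
            LIMSEQ_Suc[OF lim_1_over_n])
      ultimately show ?thesis
        by (intro LIMSEQ_le_const[where X =
              "\<lambda>n. 2 * t * (ip (u n) g - L g) + t\<^sup>2 * b + 1 / real (Suc n)"]) auto
    qed
    have b: "0 \<le> b"
      using ip_nonneg[OF g] by (simp add: b_def)
    \<comment> \<open>The choice \<open>t = - a / (b + 1)\<close> makes the expression negative unless \<open>a = 0\<close>; the summand
      \<open>1\<close> covers the case \<open>b = 0\<close>.\<close>
    have "2 * (- a / (b + 1)) * a + (- a / (b + 1))\<^sup>2 * b = - (a\<^sup>2 * (b + 2)) / (b + 1)\<^sup>2"
      using b by (simp add: power2_eq_square divide_simps) (simp add: algebra_simps)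
    then have "a\<^sup>2 * (b + 2) / (b + 1)\<^sup>2 \<le> 0"
      using var[of "- a / (b + 1)"] by simp
    then have "a = 0"
      using b by (simp add: divide_le_0_iff mult_le_0_iff)
    then show ?thesis
      using ip_commute[OF g \<phi>] by (simp add: a_def)
  qed
  with \<phi> show ?thesis
    by blast
qed

text \<open>The projection \<open>w\<close> of \<open>f\<close> represents the functional \<open>g \<mapsto> \<langle>g, f\<rangle>\<close> on the Hilbert space \<open>W\<close>.\<close>

lemma orthogonal_projection:
  assumes W: "W \<subseteq> V" "function_subspace W" "complete_on W (\<lambda>f. sqrt (ip f f))"
    and f: "f \<in> V"
  shows "\<exists>w\<in>W. \<forall>g\<in>W. ip (\<lambda>x. f x - w x) g = 0"
proof -
  interpret W: inner_function_space W ip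
  proof
    show "inner_product_on W ip"
      using inner W(1) unfolding inner_product_on_def by (meson subsetD)
  qed fact
  have "linear_functional_on W (\<lambda>g. ip g f)"
    using ip_linear_left[OF f] W(1) unfolding linear_functional_on_def by blast
  moreover have "\<bar>ip g f\<bar> \<le> sqrt (ip f f) * sqrt (ip g g)" if "g \<in> W" for g
    using Cauchy_Schwarz[of g f] that W(1) f by (auto simp: mult.commute)
  ultimately obtain w where w: "w \<in> W" "\<And>g. g \<in> W \<Longrightarrow> ip g f = ip g w"
    using W.riesz_representation[OF W(3)] by blast
  have "ip (\<lambda>x. f x - w x) g = 0" if g: "g \<in> W" for g
  proof -
    have "g \<in> V" "w \<in> V"
      using g w(1) W(1) by auto
    then show ?thesis
      using w(2)[OF g] ip_diff_left[of f w g] ip_commute[of g] f by simp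
  qed
  with w(1) show ?thesis
    by blast
qed

text \<open>The orthogonal complement within \<open>V\<close> of an arbitrary set \<open>S\<close> of functions in \<open>V\<close>.\<close>

definition orthogonal_complement :: "('s \<Rightarrow> real) set \<Rightarrow> ('s \<Rightarrow> real) set" where
  "orthogonal_complement S = {f \<in> V. \<forall>s\<in>S. ip f s = 0}"

lemma orthogonal_complement_subspace:
  assumes "S \<subseteq> V"
  shows "function_subspace (orthogonal_complement S)"
  using assms
  by (auto simp: function_subspace_def orthogonal_complement_def zero_mem add_mem scale_mem
      ip_zero_left ip_add_left ip_scale_left subset_iff)

lemma orthogonal_complement_complete:
  assumes complete: "complete_on V (\<lambda>f. sqrt (ip f f))" and S: "S \<subseteq> V"
  shows "complete_on (orthogonal_complement S) (\<lambda>f. sqrt (ip f f))"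
  unfolding complete_on_def
proof (intro allI impI)
  fix u :: "nat \<Rightarrow> 's \<Rightarrow> real"
  assume u: "\<forall>n. u n \<in> orthogonal_complement S"
    and cauchy: "\<forall>e>0. \<exists>n0. \<forall>m\<ge>n0. \<forall>n\<ge>n0.
      sqrt (ip (\<lambda>x. u m x - u n x) (\<lambda>x. u m x - u n x)) < e"
  have uV: "u n \<in> V" and ortho: "s \<in> S \<Longrightarrow> ip (u n) s = 0" for n s
    using u by (auto simp: orthogonal_complement_def)
  obtain f where f: "f \<in> V"
    and lim: "(\<lambda>n. sqrt (ip (\<lambda>x. u n x - f x) (\<lambda>x. u n x - f x))) \<longlonglongrightarrow> 0"
    using complete uV cauchy unfolding complete_on_def by blast
  have "ip f s = 0" if "s \<in> S" for s
    using tendsto_ip_left[OF uV f _ lim, of s] ortho[OF that] that S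
    by (auto simp: LIMSEQ_const_iff)
  with f lim show "\<exists>f\<in>orthogonal_complement S.
      (\<lambda>n. sqrt (ip (\<lambda>x. u n x - f x) (\<lambda>x. u n x - f x))) \<longlonglongrightarrow> 0"
    by (auto simp: orthogonal_complement_def)
qed

end

lemma hilbert_function_spaceD:
  assumes "hilbert_function_space V ip"
  shows "inner_function_space V ip" "complete_on V (\<lambda>f. sqrt (ip f f))"
  using assms by (auto simp: hilbert_function_space_def inner_function_space_def
      function_space_def inner_function_space_axioms_def)

section \<open>The reproducing kernel of a feature map\<close>

text \<open>Let \<open>B h x = \<langle>h, \<phi> x\<rangle>\<close>. The null space of \<open>B\<close> is the orthogonal complement of the features
  \<open>\<phi> x\<close>, so \<open>B\<close> is injective on the orthogonal complement \<open>K\<close> of its null space, maps \<open>K\<close> onto its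
  whole image, and carries the inner product of \<open>K\<close> over to the image. As \<open>\<phi> x\<close> lies in \<open>K\<close>, the identity
  \<open>B h x = \<langle>h, \<phi> x\<rangle>\<close> becomes the reproducing property of \<open>B (\<phi> x)\<close>.\<close>

lemma rkhs_feature_map_image:
  fixes H :: "('a \<Rightarrow> real) set" and \<phi> :: "'b \<Rightarrow> 'a \<Rightarrow> real"
  assumes H: "hilbert_function_space H ip"
    and \<phi>: "\<And>x. \<phi> x \<in> H"
    and B: "\<And>h x. h \<in> H \<Longrightarrow> B h x = ip h (\<phi> x)"
  shows "\<exists>ip'. rkhs (B ` H) ip' \<and> reproducing_kernel (B ` H) ip' (\<lambda>x y. ip (\<phi> x) (\<phi> y))"
proof -
  interpret H: inner_function_space H ip
    using H by (rule hilbert_function_spaceD)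
  note complete = hilbert_function_spaceD(2)[OF H]
  define Z where "Z = H.orthogonal_complement (range \<phi>)"
  define K where "K = H.orthogonal_complement Z"
  have range_\<phi>: "range \<phi> \<subseteq> H"
    using \<phi> by blast
  have ZH: "Z \<subseteq> H" and KH: "K \<subseteq> H"
    by (auto simp: Z_def K_def H.orthogonal_complement_def)
  have K_subspace: "function_subspace K"
    unfolding K_def by (rule H.orthogonal_complement_subspace[OF ZH])
  interpret K: inner_function_space K ip
  proof
    show "inner_product_on K ip"
      using H.inner KH unfolding inner_product_on_def by (meson subsetD)
  qed (fact K_subspace)
  have K_complete: "complete_on K (\<lambda>f. sqrt (ip f f))"
    unfolding K_def by (rule H.orthogonal_complement_complete[OF complete ZH])
  have \<phi>K: "\<phi> x \<in> K" for x
    using \<phi> H.ip_commute by (auto simp: K_def Z_def H.orthogonal_complement_def)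
  have BK: "B h = (\<lambda>x. ip h (\<phi> x))" if "h \<in> K" for h
    using B that KH by blast
  have inj: "h = h'" if "h \<in> K" "h' \<in> K" "B h = B h'" for h h'
  proof -
    let ?d = "\<lambda>x. h x - h' x"
    have d: "?d \<in> K"
      using that by (intro K.diff_mem)
    have "ip ?d (\<phi> x) = 0" for x
      using that(3) BK[OF that(1)] BK[OF that(2)] K.ip_diff_left[OF that(1,2) \<phi>K, of x]
      by (simp add: fun_eq_iff)
    then have "?d \<in> Z"
      using d KH by (auto simp: Z_def H.orthogonal_complement_def)
    then have "ip ?d ?d = 0"
      using d by (simp add: K_def H.orthogonal_complement_def)
    then show ?thesis
      using K.ip_eq_0[OF d] by (simp add: fun_eq_iff)
  qed
  have image: "B ` H = B ` K"
  proof
    show "B ` H \<subseteq> B ` K"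
    proof
      fix f assume "f \<in> B ` H"
      then obtain h where h: "h \<in> H" "f = B h"
        by blast
      obtain z where z: "z \<in> Z" "\<And>g. g \<in> Z \<Longrightarrow> ip (\<lambda>x. h x - z x) g = 0"
        using H.orthogonal_projection[OF ZH _ _ h(1)]
          H.orthogonal_complement_subspace[OF range_\<phi>]
          H.orthogonal_complement_complete[OF complete range_\<phi>] by (auto simp: Z_def)
      then have zH: "z \<in> H"
        using ZH by blast
      have d: "(\<lambda>x. h x - z x) \<in> K"
        using z H.diff_mem[OF h(1) zH] by (simp add: K_def H.orthogonal_complement_def)
      have "ip z (\<phi> x) = 0" for x
        using z(1) by (simp add: Z_def H.orthogonal_complement_def)
      then have "B (\<lambda>x. h x - z x) = f"
        using BK[OF d] B[OF h(1)] H.ip_diff_left[OF h(1) zH \<phi>] h(2) by auto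
      with d show "f \<in> B ` K"
        by blast
    qed
  qed (use KH in blast)
  \<comment> \<open>Carry the inner product over along the bijection from \<open>K\<close> to the image.\<close>
  define S where "S = inv_into K B"
  have SB: "S (B h) = h" if "h \<in> K" for h
    unfolding S_def using that inj by (intro inv_into_f_f) (auto simp: inj_on_def)
  define ip' where "ip' f g = ip (S f) (S g)" for f g
  have ip'B: "ip' (B h) (B h') = ip h h'" if "h \<in> K" "h' \<in> K" for h h'
    using that SB by (simp add: ip'_def)
  have B_add: "(\<lambda>x. B h x + B h' x) = B (\<lambda>x. h x + h' x)" if "h \<in> K" "h' \<in> K" for h h'
    using BK[OF that(1)] BK[OF that(2)] BK[OF K.add_mem[OF that]]
      K.ip_add_left[OF that \<phi>K] by simp
  have B_diff: "(\<lambda>x. B h x - B h' x) = B (\<lambda>x. h x - h' x)" if "h \<in> K" "h' \<in> K" for h h'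
    using BK[OF that(1)] BK[OF that(2)] BK[OF K.diff_mem[OF that]]
      K.ip_diff_left[OF that \<phi>K] by simp
  have B_scale: "(\<lambda>x. c * B h x) = B (\<lambda>x. c * h x)" if "h \<in> K" for c h
    using BK[OF that] BK[OF K.scale_mem[OF that]] K.ip_scale_left[OF that \<phi>K] by simp
  have B_zero: "B (\<lambda>x. 0) = (\<lambda>x. 0)"
    using BK[OF K.zero_mem] K.ip_zero_left[OF \<phi>K] by simp
  have subspace: "function_subspace (B ` K)"
    unfolding function_subspace_def
    using B_add B_scale B_zero K.zero_mem K.add_mem K.scale_mem
    by (auto intro: image_eqI[OF sym])
  have inner: "inner_product_on (B ` K) ip'"
    unfolding inner_product_on_def
  proof (intro conjI ballI allI; elim imageE; hypsubst)
    fix f assume f: "f \<in> K"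
    show "ip' (B f) (B g) = ip' (B g) (B f)" if "g \<in> K" for g
      using f that ip'B K.ip_commute by simp
    show "ip' (\<lambda>x. B f x + B g x) (B h) = ip' (B f) (B h) + ip' (B g) (B h)"
      if "h \<in> K" "g \<in> K" for g h
      using f that by (simp add: B_add ip'B K.add_mem K.ip_add_left)
    show "ip' (\<lambda>x. c * B f x) (B h) = c * ip' (B f) (B h)" if "h \<in> K" for c h
      using f that by (simp add: B_scale ip'B K.scale_mem K.ip_scale_left)
    show "0 \<le> ip' (B f) (B f)"
      using f by (simp add: ip'B K.ip_nonneg)
    show "ip' (B f) (B f) = 0 \<longleftrightarrow> B f = (\<lambda>x. 0)"
      using f K.ip_eq_0[OF f] B_zero inj[OF f K.zero_mem] by (auto simp: ip'B)
  qed
  have "complete_on (B ` K) (\<lambda>f. sqrt (ip' f f))"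
    unfolding complete_on_def
  proof (intro allI impI)
    fix u :: "nat \<Rightarrow> 'b \<Rightarrow> real"
    assume "\<forall>n. u n \<in> B ` K"
      and cauchy: "\<forall>e>0. \<exists>n0. \<forall>m\<ge>n0. \<forall>n\<ge>n0.
        sqrt (ip' (\<lambda>x. u m x - u n x) (\<lambda>x. u m x - u n x)) < e"
    then have "\<forall>n. \<exists>h. h \<in> K \<and> u n = B h"
      by blast
    then obtain v where v: "\<And>n. v n \<in> K" and u: "\<And>n. u n = B (v n)"
      by metis
    have norm_eq: "ip' (\<lambda>x. B h x - B h' x) (\<lambda>x. B h x - B h' x) =
        ip (\<lambda>x. h x - h' x) (\<lambda>x. h x - h' x)" if "h \<in> K" "h' \<in> K" for h h'
      using that by (simp add: B_diff ip'B K.diff_mem)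
    obtain h where h: "h \<in> K"
      and "(\<lambda>n. sqrt (ip (\<lambda>x. v n x - h x) (\<lambda>x. v n x - h x))) \<longlonglongrightarrow> 0"
      using K_complete v cauchy unfolding complete_on_def u norm_eq[OF v v] by blast
    then have "(\<lambda>n. sqrt (ip' (\<lambda>x. u n x - B h x) (\<lambda>x. u n x - B h x))) \<longlonglongrightarrow> 0"
      unfolding u norm_eq[OF v h] by simp
    with h show "\<exists>f\<in>B ` K. (\<lambda>n. sqrt (ip' (\<lambda>x. u n x - f x) (\<lambda>x. u n x - f x))) \<longlonglongrightarrow> 0"
      by blast
  qed
  with subspace inner have hilbert: "hilbert_function_space (B ` K) ip'"
    by (simp add: hilbert_function_space_def)
  have "\<bar>B h x\<bar> \<le> sqrt (ip (\<phi> x) (\<phi> x)) * sqrt (ip' (B h) (B h))" if "h \<in> K" for h x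
    using K.Cauchy_Schwarz[OF that \<phi>K, of x] BK[OF that] ip'B[OF that that]
    by (simp add: mult.commute)
  then have "rkhs (B ` K) ip'"
    using hilbert unfolding rkhs_def by blast
  moreover have "reproducing_kernel (B ` K) ip' (\<lambda>x y. ip (\<phi> x) (\<phi> y))"
    unfolding reproducing_kernel_def
  proof (intro conjI allI ballI)
    have kernel: "(\<lambda>y. ip (\<phi> x) (\<phi> y)) = B (\<phi> x)" for x
      using BK[OF \<phi>K] by simp
    show "ip (\<phi> x) (\<phi> y) = ip (\<phi> y) (\<phi> x)" for x y
      by (rule H.ip_commute[OF \<phi> \<phi>])
    show "(\<lambda>y. ip (\<phi> x) (\<phi> y)) \<in> B ` K" for x
      unfolding kernel using \<phi>K by blast
    show "f x = ip' f (\<lambda>y. ip (\<phi> x) (\<phi> y))" if "f \<in> B ` K" for f x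
      unfolding kernel using that ip'B[OF _ \<phi>K] BK by auto
    show "positive_definite_kernel (\<lambda>x y. ip (\<phi> x) (\<phi> y))"
      unfolding positive_definite_kernel_def
    proof (intro allI impI)
      fix A c assume A: "finite (A :: 'b set)"
      let ?w = "\<lambda>z. \<Sum>x\<in>A. c x * \<phi> x z"
      have w: "?w \<in> H" and sum: "h \<in> H \<Longrightarrow> ip ?w h = (\<Sum>x\<in>A. c x * ip (\<phi> x) h)" for h
        using H.ip_sum_left[of A \<phi> _ c] A \<phi> by blast+
      have "ip ?w ?w = (\<Sum>x\<in>A. c x * ip ?w (\<phi> x))"
        using sum[OF w] H.ip_commute[OF w \<phi>] by simp
      also have "\<dots> = (\<Sum>x\<in>A. \<Sum>y\<in>A. c x * c y * ip (\<phi> x) (\<phi> y))"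
        using sum[OF \<phi>] H.ip_commute[OF \<phi> \<phi>]
        by (simp add: sum_distrib_left mult.assoc)
      finally show "0 \<le> (\<Sum>x\<in>A. \<Sum>y\<in>A. c x * c y * ip (\<phi> x) (\<phi> y))"
        using H.ip_nonneg[OF w] by simp
    qed
  qed
  ultimately show ?thesis
    unfolding image by blast
qed

section \<open>The generator on a reproducing kernel Hilbert space\<close>

text \<open>A strongly continuous semigroup on a normed space of functions with continuous point
  evaluations. These make the limit that defines the generator unique, and pointwise.\<close>

locale generator_on_function_space = normed_function_space F normF
  for F :: "('s \<Rightarrow> real) set" and normF +
  fixes T :: "real \<Rightarrow> ('s \<Rightarrow> real) \<Rightarrow> 's \<Rightarrow> real"
  assumes eval: "\<And>x. \<exists>C. \<forall>f\<in>F. \<bar>f x\<bar> \<le> C * normF f"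
    and semigroup: "strongly_continuous_semigroup F normF T"
begin

lemma bounded_operator: "0 \<le> t \<Longrightarrow> bounded_operator_on F normF (T t)"
  using semigroup by (simp add: strongly_continuous_semigroup_def)

lemma difference_quotient_mem:
  assumes "0 \<le> t" "f \<in> F"
  shows "(\<lambda>x. (1 / t) * (T t f x - f x)) \<in> F"
  using assms bounded_operator[OF assms(1)]
  by (intro scale_mem diff_mem) (auto simp: bounded_operator_on_def)

lemma generator_limit_pointwise:
  assumes f: "f \<in> F" and g: "generator_limit F normF T f g"
  shows "((\<lambda>t. (1 / t) * (T t f x - f x)) \<longlongrightarrow> g x) (at_right 0)"
proof (rule tendsto_eval[OF eval])
  show "eventually (\<lambda>t. (\<lambda>x. (1 / t) * (T t f x - f x)) \<in> F) (at_right 0)"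
    using eventually_at_right_less[of "0::real"]
    by eventually_elim (rule difference_quotient_mem[OF less_imp_le f])
qed (use g in \<open>auto simp: generator_limit_def\<close>)

lemma generator_limit_generator:
  assumes "f \<in> generator_dom F normF T"
  shows "generator_limit F normF T f (generator F normF T f)"
proof -
  obtain g where f: "f \<in> F" and g: "generator_limit F normF T f g"
    using assms by (auto simp: generator_dom_def)
  have "g' = g" if "generator_limit F normF T f g'" for g'
    using tendsto_unique[OF trivial_limit_at_right_real generator_limit_pointwise[OF f that]
        generator_limit_pointwise[OF f g]] by auto
  with g show ?thesis
    unfolding generator_def by (rule theI)
qed

lemma generator_pointwise:
  assumes "f \<in> generator_dom F normF T"
  shows "((\<lambda>t. (1 / t) * (T t f x - f x)) \<longlongrightarrow> generator F normF T f x) (at_right 0)"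
  using generator_limit_pointwise[OF _ generator_limit_generator[OF assms]] assms
  by (simp add: generator_dom_def)

lemma difference_quotient_linear:
  assumes "0 \<le> t"
  shows "linear_functional_on F (\<lambda>f. (1 / t) * (T t f x - f x))"
  using bounded_operator[OF assms]
  by (simp add: linear_functional_on_def bounded_operator_on_def algebra_simps
      flip: add_divide_distrib diff_divide_distrib)

lemma difference_quotient_bounded:
  assumes t: "0 < t"
  shows "\<exists>C\<ge>0. \<forall>f\<in>F. \<bar>(1 / t) * (T t f x - f x)\<bar> \<le> C * normF f"
proof -
  obtain C where C: "\<And>f. f \<in> F \<Longrightarrow> \<bar>f x\<bar> \<le> C * normF f"
    using eval by blast
  obtain D where TF: "\<And>f. f \<in> F \<Longrightarrow> T t f \<in> F"
    and D: "\<And>f. f \<in> F \<Longrightarrow> normF (T t f) \<le> D * normF f"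
    using bounded_operator[of t] t unfolding bounded_operator_on_def by fastforce
  let ?C = "(1 / t) * (\<bar>C\<bar> * \<bar>D\<bar> + \<bar>C\<bar>)"
  have "\<bar>(1 / t) * (T t f x - f x)\<bar> \<le> ?C * normF f" if f: "f \<in> F" for f
  proof -
    have "\<bar>f x\<bar> \<le> \<bar>C\<bar> * normF f"
      using C[OF f] mult_right_mono[OF abs_ge_self N_nonneg[OF f], of C] by simp
    moreover have "\<bar>T t f x\<bar> \<le> \<bar>C\<bar> * normF (T t f)"
      using C[OF TF[OF f]] mult_right_mono[OF abs_ge_self N_nonneg[OF TF[OF f]], of C] by simp
    moreover have "normF (T t f) \<le> \<bar>D\<bar> * normF f"
      using D[OF f] mult_right_mono[OF abs_ge_self N_nonneg[OF f], of D] by simp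
    then have "\<bar>C\<bar> * normF (T t f) \<le> \<bar>C\<bar> * (\<bar>D\<bar> * normF f)"
      by (intro mult_left_mono) auto
    ultimately have "\<bar>T t f x - f x\<bar> \<le> (\<bar>C\<bar> * \<bar>D\<bar> + \<bar>C\<bar>) * normF f"
      using abs_triangle_ineq4[of "T t f x" "f x"] by (simp add: algebra_simps)
    then show ?thesis
      using t by (simp add: abs_mult divide_right_mono)
  qed
  moreover have "0 \<le> ?C"
    using t by simp
  ultimately show ?thesis
    by blast
qed

text \<open>The functional is the pointwise limit of the difference quotients along the times
  \<open>1 / (n + 1)\<close>, which are bounded on \<open>H\<close> because \<open>T t\<close> is bounded on \<open>F\<close> and the inclusion of
  \<open>H\<close> in \<open>F\<close> is bounded.\<close>

lemma generator_evaluation_bounded: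
  assumes H: "normed_function_space H M" "complete_on H M"
    and complete: "complete_on F normF"
    and evalH: "\<And>x. \<exists>C. \<forall>h\<in>H. \<bar>h x\<bar> \<le> C * M h"
    and dom: "H \<subseteq> generator_dom F normF T"
  shows "linear_functional_on H (\<lambda>h. generator F normF T h x)"
    and "\<exists>C. \<forall>h\<in>H. \<bar>generator F normF T h x\<bar> \<le> C * M h"
proof -
  interpret H: normed_function_space H M by fact
  have HF: "H \<subseteq> F"
    using dom by (auto simp: generator_dom_def)
  define q where "q n h = (1 / inverse (real (Suc n))) * (T (inverse (real (Suc n))) h x - h x)"
    for n h
  have linF: "linear_functional_on F (q n)" for n
    unfolding q_def by (rule difference_quotient_linear) simp
  then have lin: "linear_functional_on H (q n)" for n
    using HF unfolding linear_functional_on_def by (meson subsetD)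
  have "filterlim (\<lambda>n. inverse (real (Suc n))) (at_right 0) sequentially"
    unfolding filterlim_at using LIMSEQ_inverse_real_of_nat by simp
  then have lim: "(\<lambda>n. q n h) \<longlonglongrightarrow> generator F normF T h x" if "h \<in> H" for h
    unfolding q_def using generator_pointwise[of h x] that dom
    by (intro filterlim_compose[OF generator_pointwise]) auto
  obtain D where D: "\<And>h. h \<in> H \<Longrightarrow> normF h \<le> D * M h"
    using inclusion_bounded[OF H normed_function_space_axioms complete HF evalH eval] by blast
  have bounded: "\<exists>C. \<forall>h\<in>H. \<bar>q n h\<bar> \<le> C * M h" for n
  proof -
    obtain C where C: "0 \<le> C" "\<And>h. h \<in> F \<Longrightarrow> \<bar>q n h\<bar> \<le> C * normF h"
      unfolding q_def using difference_quotient_bounded[of "inverse (real (Suc n))" x] by auto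
    have "\<bar>q n h\<bar> \<le> (C * D) * M h" if h: "h \<in> H" for h
      using C(2)[of h] mult_left_mono[OF D[OF h] C(1)] h HF by (auto simp: mult.assoc)
    then show ?thesis
      by blast
  qed
  show "\<exists>C. \<forall>h\<in>H. \<bar>generator F normF T h x\<bar> \<le> C * M h"
    by (rule pointwise_limit_of_functionals_bounded[OF H lin bounded lim])
  show "linear_functional_on H (\<lambda>h. generator F normF T h x)"
    unfolding linear_functional_on_def
  proof (intro conjI ballI allI)
    fix f assume f: "f \<in> H"
    show "generator F normF T (\<lambda>x. f x + g x) x = generator F normF T f x + generator F normF T g x"
      if g: "g \<in> H" for g
    proof (rule LIMSEQ_unique)
      show "(\<lambda>n. q n (\<lambda>x. f x + g x)) \<longlonglongrightarrow> generator F normF T (\<lambda>x. f x + g x) x"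
        by (rule lim[OF H.add_mem[OF f g]])
      have "q n (\<lambda>x. f x + g x) = q n f + q n g" for n
        using lin[of n] f g by (simp add: linear_functional_on_def)
      then show "(\<lambda>n. q n (\<lambda>x. f x + g x)) \<longlonglongrightarrow>
          generator F normF T f x + generator F normF T g x"
        using tendsto_add[OF lim[OF f] lim[OF g]] by simp
    qed
    show "generator F normF T (\<lambda>x. c * f x) x = c * generator F normF T f x" for c
    proof (rule LIMSEQ_unique)
      show "(\<lambda>n. q n (\<lambda>x. c * f x)) \<longlonglongrightarrow> generator F normF T (\<lambda>x. c * f x) x"
        by (rule lim[OF H.scale_mem[OF f]])
      have "q n (\<lambda>x. c * f x) = c * q n f" for n
        using lin[of n] f by (simp add: linear_functional_on_def)
      then show "(\<lambda>n. q n (\<lambda>x. c * f x)) \<longlonglongrightarrow> c * generator F normF T f x"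
        using tendsto_mult_left[OF lim[OF f]] by simp
    qed
  qed
qed

end

theorem proposition1:
  fixes F :: "('s::polish_space \<Rightarrow> real) set"
    and normF :: "('s \<Rightarrow> real) \<Rightarrow> real"
    and \<pi> :: "'s measure"
    and \<Omega> :: "'w measure"
    and P :: "'s \<Rightarrow> 'w measure"
    and X :: "real \<Rightarrow> 'w \<Rightarrow> 's"
    and H :: "('s \<Rightarrow> real) set"
    and ipH :: "('s \<Rightarrow> real) \<Rightarrow> ('s \<Rightarrow> real) \<Rightarrow> real"
    and k :: "'s \<Rightarrow> 's \<Rightarrow> real"
  defines "T \<equiv> transition_semigroup P X"
  defines "A \<equiv> generator F normF T"
  defines "domA \<equiv> generator_dom F normF T"
  assumes "banach_subspace_of_continuous F normF"
    and "prob_space \<pi>" and "sets \<pi> = sets borel"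
    and "markov_process \<Omega> P X"
    and "ergodic_process P X \<pi>"
    and "strongly_continuous_process_on F normF P X"
    and "rkhs H ipH" and "reproducing_kernel H ipH k" and "H \<subseteq> F"
    and "\<forall>x. (\<lambda>y. k y x) \<in> domA"
    and "H \<subseteq> domA"
  shows "operator_tensor_defined domA domA A k \<and>
         (\<exists>ip. rkhs (A ` H) ip \<and> reproducing_kernel (A ` H) ip (operator_tensor A A k))"
proof -
  have F_complete: "complete_on F normF"
    using assms(4) by (simp add: banach_subspace_of_continuous_def)
  interpret F: generator_on_function_space F normF T
  proof
    show "function_subspace F" "norm_on F normF"
      using assms(4) by (simp_all add: banach_subspace_of_continuous_def)
    show "strongly_continuous_semigroup F normF T"
      using assms(9) by (simp add: strongly_continuous_process_on_def T_def)
    fix x :: 's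
    \<comment> \<open>The bound on the compact set \<open>{x}\<close>.\<close>
    have "\<exists>C. \<forall>f\<in>F. \<forall>y\<in>{x}. \<bar>f y\<bar> \<le> C * normF f"
      using assms(4)[unfolded banach_subspace_of_continuous_def, THEN conjunct2, THEN conjunct2,
          THEN conjunct2, THEN conjunct2, rule_format, of "{x}"] by simp
    then show "\<exists>C. \<forall>f\<in>F. \<bar>f x\<bar> \<le> C * normF f"
      by simp
  qed
  have hilbert: "hilbert_function_space H ipH"
    and eval: "\<And>x. \<exists>C. \<forall>h\<in>H. \<bar>h x\<bar> \<le> C * sqrt (ipH h h)"
    using \<open>rkhs H ipH\<close> by (auto simp: rkhs_def)
  interpret H: inner_function_space H ipH
    using hilbert by (rule hilbert_function_spaceD)
  note complete = hilbert_function_spaceD(2)[OF hilbert]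
  have k_sym: "k x y = k y x" and k_mem: "(\<lambda>y. k x y) \<in> H"
    and k_repr: "h \<in> H \<Longrightarrow> h x = ipH h (\<lambda>y. k x y)" for x y h
    using \<open>reproducing_kernel H ipH k\<close> by (auto simp: reproducing_kernel_def)
  have "\<exists>\<phi>\<in>H. \<forall>h\<in>H. A h x = ipH h \<phi>" for x
  proof -
    note gen = F.generator_evaluation_bounded[OF H.normed_function_space_axioms complete
        F_complete eval \<open>H \<subseteq> domA\<close>[unfolded domA_def], of x, folded A_def]
    obtain C where "\<And>h. h \<in> H \<Longrightarrow> \<bar>A h x\<bar> \<le> C * sqrt (ipH h h)"
      using gen(2) by blast
    then show ?thesis
      by (rule H.riesz_representation[OF complete gen(1)])
  qed
  then obtain \<phi> where \<phi>: "\<And>x. \<phi> x \<in> H" and A: "\<And>h x. h \<in> H \<Longrightarrow> A h x = ipH h (\<phi> x)"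
    by metis
  \<comment> \<open>Applying the generator to the second argument of the kernel gives the representers.\<close>
  have A_k: "A (\<lambda>y'. k x y') y = \<phi> y x" for x y
    using A[OF k_mem] k_repr[OF \<phi>] H.ip_commute[OF k_mem \<phi>] by simp
  then have "operator_tensor_defined domA domA A k"
    using k_mem \<phi> \<open>H \<subseteq> domA\<close> by (auto simp: operator_tensor_defined_def)
  moreover have "operator_tensor A A k = (\<lambda>x y. ipH (\<phi> x) (\<phi> y))"
    using A[OF \<phi>] H.ip_commute[OF \<phi> \<phi>] by (simp add: operator_tensor_def A_k fun_eq_iff)
  ultimately show ?thesis
    using rkhs_feature_map_image[of H ipH \<phi> A, OF hilbert \<phi> A] by simp
qed

end
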